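(* If $f:\{0,1\}^n\to\{0,1\}$ is either symmetric or monotone, then $$\mathsf{ms}(f)=\mathsf{mbs}(f)=\mathsf{fmbs}(f)=\mathsf{MCC}(f).$$
   Context: $f$ is symmetric if $f(x)$ depends only on the Hamming weight of $x$; $f$ is monotone if it is non-decreasing or non-increasing with respect to the coordinatewise order on $\{0,1\}^n$. For $x\in\{0,1\}^n$ let $\mathrm{supp}(x)=\{i:x_i=1\}$, $|x|=|\mathrm{supp}(x)|$, and let $f_x$ be the restriction of $f$ to $\{y: y_i=1\ \forall i\in\mathrm{supp}(x)\}$, viewed as a function of the remaining $n-|x|$ coordinates. For a Boolean function $h$ and input $z$: $\mathsf{s}(h,z)$ is the number of coordinates $i$ with $h(z^{\oplus i})\ne h(z)$; $\mathsf{bs}(h,z)$ is the maximum number of pairwise disjoint sets $B$ with $h(z^B)\neq h(z)$ ($z^B$ = $z$ with bits in $B$ flipped); $\mathsf{fbs}(h,z)$ is the optimum of: maximize $\sum_{B\in W}b_B$ s.t. $\sum_{B\in W: i\in B}b_B\le 1$ for all $i$, $b_B\in[0,1]$, where $W$ is the set of sensitive blocks at $z$; $\mathsf{C}(h,z)$ is the minimum size of a set $C$ of coordinates such that every $y$ agreeing with $z$ on $C$ has $h(y)=h(z)$. Monotone measures: $\mathsf{ms}(f,x)=\mathsf{s}(f_x,0^{n-|x|})$, $\mathsf{mbs}(f,x)=\mathsf{bs}(f_x,0^{n-|x|})$, $\mathsf{fmbs}(f,x)=\mathsf{fbs}(f_x,0^{n-|x|})$, $\mathsf{MCC}(f,x)=\mathsf{C}(f_x,0^{n-|x|})$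 (hitting set complexity); each measure of $f$ is the maximum over $x\in\{0,1\}^n$. *)

theory Defs
  imports Complex_Main "HOL-Library.FuncSet"
begin

text \<open>
  The Boolean cube over a finite set \<open>I\<close> of coordinates consists of the extensional functions
  \<open>I \<rightarrow> bool\<close>.  Keeping \<open>I\<close> explicit (rather than a fixed dimension) lets the restriction of a
  function to a subcube live on the set of remaining coordinates without renumbering them.
  A Boolean function on \<open>cube I\<close> is a HOL function of which only the values on \<open>cube I\<close> matter.
\<close>

definition cube :: "nat set \<Rightarrow> (nat \<Rightarrow> bool) set" where
  "cube I = I \<rightarrow>\<^sub>E UNIV"

definition supp :: "nat set \<Rightarrow> (nat \<Rightarrow> bool) \<Rightarrow> nat set" where
  "supp I x = {i \<in> I. x i}"

definition zero_input :: "nat set \<Rightarrow> nat \<Rightarrow> bool" where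
  "zero_input I = (\<lambda>i\<in>I. False)"

definition flip :: "(nat \<Rightarrow> bool) \<Rightarrow> nat set \<Rightarrow> nat \<Rightarrow> bool" where
  "flip z B = (\<lambda>i. if i \<in> B then \<not> z i else z i)"

definition symmetric_fun :: "nat set \<Rightarrow> ((nat \<Rightarrow> bool) \<Rightarrow> bool) \<Rightarrow> bool" where
  "symmetric_fun I f \<longleftrightarrow>
     (\<forall>x\<in>cube I. \<forall>y\<in>cube I. card (supp I x) = card (supp I y) \<longrightarrow> f x = f y)"

text \<open>
  All members of \<open>cube I\<close> agree outside \<open>I\<close>, so the pointwise order on functions is the
  coordinatewise order there.
\<close>

definition monotone_fun :: "nat set \<Rightarrow> ((nat \<Rightarrow> bool) \<Rightarrow> bool) \<Rightarrow> bool" where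
  "monotone_fun I f \<longleftrightarrow> mono_on (cube I) f \<or> antimono_on (cube I) f"

definition sensitivity_at :: "nat set \<Rightarrow> ((nat \<Rightarrow> bool) \<Rightarrow> bool) \<Rightarrow> (nat \<Rightarrow> bool) \<Rightarrow> nat" where
  "sensitivity_at I h z = card {i \<in> I. h (flip z {i}) \<noteq> h z}"

definition sensitive_blocks :: "nat set \<Rightarrow> ((nat \<Rightarrow> bool) \<Rightarrow> bool) \<Rightarrow> (nat \<Rightarrow> bool) \<Rightarrow> nat set set" where
  "sensitive_blocks I h z = {B. B \<subseteq> I \<and> h (flip z B) \<noteq> h z}"

definition block_sensitivity_at :: "nat set \<Rightarrow> ((nat \<Rightarrow> bool) \<Rightarrow> bool) \<Rightarrow> (nat \<Rightarrow> bool) \<Rightarrow> nat" where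
  "block_sensitivity_at I h z =
     Max {card F | F. F \<subseteq> sensitive_blocks I h z \<and> pairwise disjnt F}"

definition fractional_packing ::
  "nat set \<Rightarrow> ((nat \<Rightarrow> bool) \<Rightarrow> bool) \<Rightarrow> (nat \<Rightarrow> bool) \<Rightarrow> (nat set \<Rightarrow> real) \<Rightarrow> bool" where
  "fractional_packing I h z b \<longleftrightarrow>
     (\<forall>B\<in>sensitive_blocks I h z. b B \<in> {0..1}) \<and>
     (\<forall>i\<in>I. (\<Sum>B\<in>{B \<in> sensitive_blocks I h z. i \<in> B}. b B) \<le> 1)"

definition fractional_block_sensitivity_at ::
  "nat set \<Rightarrow> ((nat \<Rightarrow> bool) \<Rightarrow> bool) \<Rightarrow> (nat \<Rightarrow> bool) \<Rightarrow> real" where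
  "fractional_block_sensitivity_at I h z =
     Sup {(\<Sum>B\<in>sensitive_blocks I h z. b B) | b. fractional_packing I h z b}"

definition certificate :: "nat set \<Rightarrow> ((nat \<Rightarrow> bool) \<Rightarrow> bool) \<Rightarrow> (nat \<Rightarrow> bool) \<Rightarrow> nat set \<Rightarrow> bool" where
  "certificate I h z C \<longleftrightarrow>
     C \<subseteq> I \<and> (\<forall>y\<in>cube I. (\<forall>i\<in>C. y i = z i) \<longrightarrow> h y = h z)"

definition certificate_complexity_at ::
  "nat set \<Rightarrow> ((nat \<Rightarrow> bool) \<Rightarrow> bool) \<Rightarrow> (nat \<Rightarrow> bool) \<Rightarrow> nat" where
  "certificate_complexity_at I h z = Min {card C | C. certificate I h z C}"

text \<open>\<open>restrict_ones I f x\<close> is $f_x$, a function on \<open>cube (I - supp I x)\<close>.\<close>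

definition restrict_ones ::
  "nat set \<Rightarrow> ((nat \<Rightarrow> bool) \<Rightarrow> bool) \<Rightarrow> (nat \<Rightarrow> bool) \<Rightarrow> (nat \<Rightarrow> bool) \<Rightarrow> bool" where
  "restrict_ones I f x = (\<lambda>y. f (\<lambda>i. if i \<in> supp I x then True else y i))"

definition ms_at :: "nat set \<Rightarrow> ((nat \<Rightarrow> bool) \<Rightarrow> bool) \<Rightarrow> (nat \<Rightarrow> bool) \<Rightarrow> nat" where
  "ms_at I f x =
     sensitivity_at (I - supp I x) (restrict_ones I f x) (zero_input (I - supp I x))"

definition mbs_at :: "nat set \<Rightarrow> ((nat \<Rightarrow> bool) \<Rightarrow> bool) \<Rightarrow> (nat \<Rightarrow> bool) \<Rightarrow> nat" where
  "mbs_at I f x =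
     block_sensitivity_at (I - supp I x) (restrict_ones I f x) (zero_input (I - supp I x))"

definition fmbs_at :: "nat set \<Rightarrow> ((nat \<Rightarrow> bool) \<Rightarrow> bool) \<Rightarrow> (nat \<Rightarrow> bool) \<Rightarrow> real" where
  "fmbs_at I f x =
     fractional_block_sensitivity_at (I - supp I x) (restrict_ones I f x) (zero_input (I - supp I x))"

definition MCC_at :: "nat set \<Rightarrow> ((nat \<Rightarrow> bool) \<Rightarrow> bool) \<Rightarrow> (nat \<Rightarrow> bool) \<Rightarrow> nat" where
  "MCC_at I f x =
     certificate_complexity_at (I - supp I x) (restrict_ones I f x) (zero_input (I - supp I x))"

definition ms :: "nat set \<Rightarrow> ((nat \<Rightarrow> bool) \<Rightarrow> bool) \<Rightarrow> nat" where
  "ms I f = Max (ms_at I f ` cube I)"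

definition mbs :: "nat set \<Rightarrow> ((nat \<Rightarrow> bool) \<Rightarrow> bool) \<Rightarrow> nat" where
  "mbs I f = Max (mbs_at I f ` cube I)"

definition fmbs :: "nat set \<Rightarrow> ((nat \<Rightarrow> bool) \<Rightarrow> bool) \<Rightarrow> real" where
  "fmbs I f = Max (fmbs_at I f ` cube I)"

definition MCC :: "nat set \<Rightarrow> ((nat \<Rightarrow> bool) \<Rightarrow> bool) \<Rightarrow> nat" where
  "MCC I f = Max (MCC_at I f ` cube I)"

end

theory Submission
  imports Defs
begin

text \<open>
  For every input the measures increase in the order ms, mbs, fmbs, MCC.  It therefore suffices to
  bound the hitting set complexity at an input by the monotone sensitivity at another one.  Identify
  inputs with their supports, and enlarge the support \<open>S\<close> of the given input to a maximal \<open>T\<close> such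
  that \<open>f\<close> is constant on the interval between \<open>S\<close> and \<open>T\<close>.  The complement of \<open>T\<close> is a
  certificate at \<open>S\<close>.  If \<open>f\<close> is symmetric or monotone and \<open>f\<close> took the same value at
  \<open>insert i T\<close> as at \<open>T\<close>, it would be constant on the interval from \<open>S\<close> to \<open>insert i T\<close>.
  Hence each coordinate outside \<open>T\<close> is sensitive at \<open>T\<close>.
\<close>

section \<open>Comparison of the pointwise measures\<close>

lemma flip_empty [simp]: "flip z {} = z"
  by (simp add: flip_def)

lemma flip_in_cube: "z \<in> cube I \<Longrightarrow> B \<subseteq> I \<Longrightarrow> flip z B \<in> cube I"
  by (auto simp: cube_def flip_def PiE_iff extensional_def)

lemma finite_cube: "finite I \<Longrightarrow> finite (cube I)"
  unfolding cube_def by (rule finite_PiE) auto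

lemma zero_input_in_cube: "zero_input I \<in> cube I"
  by (simp add: zero_input_def cube_def)

lemma finite_sensitive_blocks: "finite I \<Longrightarrow> finite (sensitive_blocks I h z)"
  unfolding sensitive_blocks_def by (rule finite_subset[of _ "Pow I"]) auto

lemma finite_block_families:
  assumes "finite I"
  shows "finite {card F | F. F \<subseteq> sensitive_blocks I h z \<and> pairwise disjnt F}"
proof (rule finite_subset)
  show "finite (card ` Pow (sensitive_blocks I h z))"
    using finite_sensitive_blocks[OF assms] by simp
qed auto

text \<open>The sensitive coordinates, taken as singletons, form a disjoint family of sensitive
  blocks.\<close>

lemma sensitivity_le_block_sensitivity:
  assumes "finite I"
  shows "sensitivity_at I h z \<le> block_sensitivity_at I h z"
proof -
  let ?S = "{i \<in> I. h (flip z {i}) \<noteq> h z}"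
  let ?F = "(\<lambda>i. {i}) ` ?S"
  have "card ?S = card ?F"
    by (simp add: card_image)
  moreover have "?F \<subseteq> sensitive_blocks I h z" "pairwise disjnt ?F"
    by (auto simp: sensitive_blocks_def pairwise_def)
  ultimately have "card ?S \<in> {card F | F. F \<subseteq> sensitive_blocks I h z \<and> pairwise disjnt F}"
    by blast
  then show ?thesis
    unfolding sensitivity_at_def block_sensitivity_at_def
    by (intro Max_ge finite_block_families assms)
qed

text \<open>Flipping a block that avoids \<open>C\<close> changes no coordinate of \<open>C\<close>,
  so the certificate forbids a change of value. Certificates are thus hitting sets for the sensitive
  blocks.\<close>

lemma certificate_hits_sensitive_block:
  assumes "certificate I h z C" "B \<in> sensitive_blocks I h z" "z \<in> cube I"
  shows "B \<inter> C \<noteq> {}"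
proof
  assume "B \<inter> C = {}"
  then have "\<forall>i\<in>C. flip z B i = z i"
    by (auto simp: flip_def)
  moreover have "flip z B \<in> cube I"
    using assms by (auto intro: flip_in_cube simp: sensitive_blocks_def)
  ultimately show False
    using assms(1,2) unfolding certificate_def sensitive_blocks_def by blast
qed

text \<open>This is weak linear programming duality: the indicator of the hitting set
  \<open>C\<close> is a feasible solution of the dual covering problem.\<close>

lemma fractional_packing_le_card_certificate:
  assumes "finite I" "z \<in> cube I" "fractional_packing I h z b" "certificate I h z C"
  shows "(\<Sum>B\<in>sensitive_blocks I h z. b B) \<le> real (card C)"
proof -
  let ?W = "sensitive_blocks I h z"
  have finW: "finite ?W"
    using assms by (simp add: finite_sensitive_blocks)
  have CI: "C \<subseteq> I"
    using assms by (simp add: certificate_def)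
  then have finC: "finite C"
    using assms finite_subset by blast
  have b0: "b B \<ge> 0" if "B \<in> ?W" for B
    using assms that by (auto simp: fractional_packing_def)
  \<comment> \<open>Charge the weight of each block to every element of \<open>C\<close> in it;
    there is at least one. Swapping the sums then bounds the charge at each element by the packing
    constraint.\<close>
  have "(\<Sum>B\<in>?W. b B) \<le> (\<Sum>B\<in>?W. \<Sum>i\<in>C. if i \<in> B then b B else 0)"
  proof (rule sum_mono)
    fix B assume B: "B \<in> ?W"
    then obtain i where i: "i \<in> B" "i \<in> C"
      using certificate_hits_sensitive_block[OF assms(4) B assms(2)] by blast
    have "(if i \<in> B then b B else 0) \<le> (\<Sum>i\<in>C. if i \<in> B then b B else 0)"
      by (rule member_le_sum) (use i finC b0[OF B] in auto)
    then show "b B \<le> (\<Sum>i\<in>C. if i \<in> B then b B else 0)"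
      using i by simp
  qed
  also have "\<dots> = (\<Sum>i\<in>C. \<Sum>B\<in>?W. if i \<in> B then b B else 0)"
    by (rule sum.swap)
  also have "\<dots> = (\<Sum>i\<in>C. \<Sum>B\<in>{B \<in> ?W. i \<in> B}. b B)"
    by (intro sum.cong refl sum.inter_filter[symmetric] finW)
  also have "\<dots> \<le> (\<Sum>i\<in>C. 1)"
    using assms CI by (intro sum_mono) (auto simp: fractional_packing_def)
  finally show ?thesis
    by simp
qed

text \<open>This makes the minimum defining certificate complexity range over a nonempty set, and it
  gives a uniform bound on all packings.\<close>

lemma certificate_full:
  assumes "z \<in> cube I"
  shows "certificate I h z I"
  unfolding certificate_def
proof (intro conjI ballI impI)
  fix y assume "y \<in> cube I" "\<forall>i\<in>I. y i = z i"
  then have "y = z"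
    using assms unfolding cube_def by (intro PiE_ext) auto
  then show "h y = h z"
    by simp
qed simp

lemma bdd_above_fractional_packings:
  assumes "finite I" "z \<in> cube I"
  shows "bdd_above {(\<Sum>B\<in>sensitive_blocks I h z. b B) | b. fractional_packing I h z b}"
  using fractional_packing_le_card_certificate[OF assms _ certificate_full[OF assms(2)]]
  by (intro bdd_aboveI[of _ "real (card I)"]) auto

lemma finite_certificate_sizes:
  assumes "finite I"
  shows "finite {card C | C. certificate I h z C}"
proof (rule finite_subset)
  show "finite (card ` Pow I)"
    using assms by simp
qed (auto simp: certificate_def)

lemma fractional_block_sensitivity_le_certificate_complexity:
  assumes "finite I" "z \<in> cube I"
  shows "fractional_block_sensitivity_at I h z \<le> real (certificate_complexity_at I h z)"
proof -
  have "certificate_complexity_at I h z \<in> {card C | C. certificate I h z C}"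
    unfolding certificate_complexity_at_def
    using certificate_full[OF assms(2)] by (intro Min_in finite_certificate_sizes assms) blast
  then obtain C where C: "certificate I h z C" "certificate_complexity_at I h z = card C"
    by blast
  \<comment> \<open>The zero packing shows that the supremum is over a nonempty set.\<close>
  have "fractional_packing I h z (\<lambda>_. 0)"
    by (simp add: fractional_packing_def)
  then have "{(\<Sum>B\<in>sensitive_blocks I h z. b B) | b. fractional_packing I h z b} \<noteq> {}"
    by blast
  then show ?thesis
    unfolding fractional_block_sensitivity_at_def C(2)
    by (rule cSup_least) (use fractional_packing_le_card_certificate[OF assms _ C(1)] in blast)
qed

text \<open>The indicator of an optimal disjoint family is an integral point of the packing
  problem.\<close>

lemma block_sensitivity_le_fractional_block_sensitivity:
  assumes "finite I" "z \<in> cube I"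
  shows "real (block_sensitivity_at I h z) \<le> fractional_block_sensitivity_at I h z"
proof -
  let ?W = "sensitive_blocks I h z"
  have finW: "finite ?W"
    using assms by (simp add: finite_sensitive_blocks)
  have "block_sensitivity_at I h z \<in> {card F | F. F \<subseteq> ?W \<and> pairwise disjnt F}"
    unfolding block_sensitivity_at_def
    by (intro Max_in finite_block_families assms) (auto intro!: exI[of _ "{}"])
  then obtain F where F: "F \<subseteq> ?W" "pairwise disjnt F" "block_sensitivity_at I h z = card F"
    by blast
  let ?b = "\<lambda>B. of_bool (B \<in> F) :: real"
  have finF: "finite F"
    using F finW finite_subset by blast
  have "(\<Sum>B\<in>{B \<in> ?W. i \<in> B}. ?b B) \<le> 1" for i
  proof -
    have "(\<Sum>B\<in>{B \<in> ?W. i \<in> B}. ?b B) = real (card {B \<in> F. i \<in> B})"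
      using F finW by (auto intro!: arg_cong[where f = card])
    \<comment> \<open>Two distinct members of \<open>F\<close> containing \<open>i\<close> would not
      be disjoint.\<close>
    also have "card {B \<in> F. i \<in> B} \<le> Suc 0"
      using F(2) finF by (subst card_le_Suc0_iff_eq) (auto simp: pairwise_def disjnt_def)
    finally show ?thesis
      by simp
  qed
  then have "fractional_packing I h z ?b"
    by (simp add: fractional_packing_def)
  moreover have "(\<Sum>B\<in>?W. ?b B) = real (card F)"
    using F finW by (auto simp: Int_absorb1 intro!: arg_cong[where f = card])
  ultimately show ?thesis
    unfolding fractional_block_sensitivity_at_def F(3)
    by (intro cSup_upper bdd_above_fractional_packings assms CollectI exI[of _ ?b]) auto
qed

section \<open>Hitting set complexity and monotone sensitivity\<close>

text \<open>Inverse to \<open>supp I\<close> on subsets of \<open>I\<close>; it lets inputs be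
  handled as sets.\<close>

definition char_input :: "nat set \<Rightarrow> nat set \<Rightarrow> nat \<Rightarrow> bool" where
  "char_input I S = (\<lambda>i\<in>I. i \<in> S)"

lemma char_input_in_cube: "char_input I S \<in> cube I"
  by (simp add: char_input_def cube_def)

lemma supp_char_input: "S \<subseteq> I \<Longrightarrow> supp I (char_input I S) = S"
  by (auto simp: supp_def char_input_def)

lemma char_input_mono: "S \<subseteq> T \<Longrightarrow> char_input I S \<le> char_input I T"
  by (auto simp: char_input_def le_fun_def)

text \<open>Blocks at the zero input of a restriction become supersets of the support of
  \<open>x\<close>, so the restricted function need not be mentioned any more.\<close>

lemma restrict_ones_flip_zero_input:
  assumes "B \<subseteq> I - supp I x"
  shows "restrict_ones I f x (flip (zero_input (I - supp I x)) B) = f (char_input I (supp I x \<union> B))"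
  unfolding restrict_ones_def
  by (rule arg_cong[where f = f])
     (use assms in \<open>auto simp: fun_eq_iff flip_def zero_input_def char_input_def supp_def\<close>)

lemma restrict_ones_zero_input:
  "restrict_ones I f x (zero_input (I - supp I x)) = f (char_input I (supp I x))"
  using restrict_ones_flip_zero_input[of "{}" I x f] by simp

lemma eq_flip_zero_input: "y \<in> cube I \<Longrightarrow> y = flip (zero_input I) (supp I y)"
  by (auto simp: fun_eq_iff cube_def flip_def zero_input_def supp_def PiE_iff extensional_def)

definition constant_between :: "nat set \<Rightarrow> ((nat \<Rightarrow> bool) \<Rightarrow> bool) \<Rightarrow> nat set \<Rightarrow> nat set \<Rightarrow> bool" where
  "constant_between I f S T \<longleftrightarrow>
     (\<forall>B. S \<subseteq> B \<and> B \<subseteq> T \<longrightarrow> f (char_input I B) = f (char_input I S))"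

text \<open>Fixing the coordinates outside \<open>T\<close> to zero leaves only inputs whose
  support, joined with that of \<open>x\<close>, lies between \<open>supp I x\<close> and
  \<open>T\<close>, where \<open>f\<close> is constant.\<close>

lemma MCC_at_le_card:
  assumes "finite I" "supp I x \<subseteq> T" "T \<subseteq> I" "constant_between I f (supp I x) T"
  shows "MCC_at I f x \<le> card (I - T)"
proof -
  let ?J = "I - supp I x"
  have "certificate ?J (restrict_ones I f x) (zero_input ?J) (I - T)"
    unfolding certificate_def
  proof (intro conjI ballI impI)
    show "I - T \<subseteq> ?J"
      using assms by blast
    fix y assume y: "y \<in> cube ?J" "\<forall>i\<in>I - T. y i = zero_input ?J i"
    let ?B = "supp ?J y"
    have "?B \<subseteq> ?J"
      by (auto simp: supp_def)
    then have fy: "restrict_ones I f x y = f (char_input I (supp I x \<union> ?B))"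
      using restrict_ones_flip_zero_input eq_flip_zero_input[OF y(1)] by metis
    have "?B \<subseteq> T"
    proof
      fix i assume "i \<in> ?B"
      then have "i \<in> ?J" "y i" "\<not> zero_input ?J i"
        by (auto simp: supp_def zero_input_def)
      then show "i \<in> T"
        using y(2) by auto
    qed
    then have "f (char_input I (supp I x \<union> ?B)) = f (char_input I (supp I x))"
      using assms(2,4) unfolding constant_between_def by blast
    then show "restrict_ones I f x y = restrict_ones I f x (zero_input ?J)"
      by (simp only: fy restrict_ones_zero_input)
  qed
  then show ?thesis
    unfolding MCC_at_def certificate_complexity_at_def
    by (intro Min_le finite_certificate_sizes) (use assms(1) in auto)
qed

lemma ms_at_char_input:
  assumes "T \<subseteq> I"
    and "\<And>i. i \<in> I - T \<Longrightarrow> f (char_input I (insert i T)) \<noteq> f (char_input I T)"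
  shows "ms_at I f (char_input I T) = card (I - T)"
proof -
  let ?x = "char_input I T"
  have "restrict_ones I f ?x (flip (zero_input (I - T)) {i})
        \<noteq> restrict_ones I f ?x (zero_input (I - T))" if "i \<in> I - T" for i
    using restrict_ones_flip_zero_input[of "{i}" I ?x f] restrict_ones_zero_input[of I f ?x]
      assms that by (simp add: supp_char_input)
  then show ?thesis
    unfolding ms_at_def sensitivity_at_def supp_char_input[OF assms(1)]
    by (intro arg_cong[where f = card]) blast
qed

text \<open>Only \<open>insert i T\<close> itself has more elements than \<open>T\<close>. Any other
  set in the larger interval has the size of some set between \<open>S\<close> and \<open>T\<close>,
  hence the same value.\<close>

lemma constant_between_symmetric:
  assumes "finite I" "symmetric_fun I f" "S \<subseteq> T" "i \<in> I - T" "T \<subseteq> I"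
    and const: "constant_between I f S T"
    and eq: "f (char_input I (insert i T)) = f (char_input I T)"
  shows "constant_between I f S (insert i T)"
  unfolding constant_between_def
proof (intro allI impI)
  fix B assume B: "S \<subseteq> B \<and> B \<subseteq> insert i T"
  have card_cong: "f (char_input I A) = f (char_input I A')"
    if "A \<subseteq> I" "A' \<subseteq> I" "card A = card A'" for A A'
    using assms(2) that unfolding symmetric_fun_def
    by (simp add: char_input_in_cube supp_char_input)
  have BI: "B \<subseteq> I"
    using B assms by blast
  have fin: "finite T" "finite B"
    using finite_subset[OF BI assms(1)] finite_subset[OF assms(5,1)] by auto
  have fT: "f (char_input I T) = f (char_input I S)"
    using const assms(3) unfolding constant_between_def by blast
  show "f (char_input I B) = f (char_input I S)"
  proof (cases "card B \<le> card T")
    case True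
    have "card S \<le> card B"
      using B fin by (simp add: card_mono)
    \<comment> \<open>\<open>B\<close> may contain \<open>i\<close>; replace it by a set of equal
      size inside the old interval.\<close>
    then obtain A where A: "S \<subseteq> A" "A \<subseteq> T" "card A = card B"
      using exists_subset_between[OF _ True assms(3) fin(1)] by blast
    then have "f (char_input I B) = f (char_input I A)"
      using assms(5) BI by (intro card_cong) auto
    then show ?thesis
      using A const unfolding constant_between_def by blast
  next
    case False
    moreover have "card (insert i T) = Suc (card T)"
      using assms fin by simp
    ultimately have "B = insert i T"
      using B fin by (intro card_seteq) auto
    then show ?thesis
      using eq fT by simp
  qed
qed

text \<open>The value at any \<open>B\<close> in the interval is squeezed between the equal values
  at its ends.\<close>

lemma constant_between_monotone:
  assumes "monotone_fun I f" "S \<subseteq> T" "f (char_input I T) = f (char_input I S)"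
  shows "constant_between I f S T"
  unfolding constant_between_def
proof (intro allI impI)
  fix B assume "S \<subseteq> B \<and> B \<subseteq> T"
  then have *: "char_input I S \<le> char_input I B" "char_input I B \<le> char_input I T"
    by (simp_all add: char_input_mono)
  from assms(1) show "f (char_input I B) = f (char_input I S)"
    unfolding monotone_fun_def
  proof
    assume "mono_on (cube I) f"
    from mono_onD[OF this char_input_in_cube char_input_in_cube *(1)]
      mono_onD[OF this char_input_in_cube char_input_in_cube *(2)]
    show ?thesis
      using assms(3) by auto
  next
    assume "antimono_on (cube I) f"
    then have "f (char_input I B) \<le> f (char_input I S)" "f (char_input I T) \<le> f (char_input I B)"
      using * char_input_in_cube unfolding monotone_on_def by blast+
    then show ?thesis
      using assms(3) by auto
  qed
qed

lemma MCC_at_le_ms_at: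
  assumes "finite I" "symmetric_fun I f \<or> monotone_fun I f"
  shows "\<exists>y\<in>cube I. MCC_at I f x \<le> ms_at I f y"
proof -
  let ?S = "supp I x"
  let ?A = "{T. ?S \<subseteq> T \<and> T \<subseteq> I \<and> constant_between I f ?S T}"
  have "finite ?A"
    using assms(1) by (intro finite_subset[of ?A "Pow I"]) auto
  \<comment> \<open>The one-point interval starts the search for a maximal \<open>T\<close>.\<close>
  moreover have "?S \<in> ?A"
    by (auto simp: constant_between_def supp_def)
  ultimately have "\<exists>T\<in>?A. ?S \<subseteq> T \<and> (\<forall>T'\<in>?A. T \<subseteq> T' \<longrightarrow> T = T')"
    by (rule finite_has_maximal2)
  then obtain T where T: "T \<in> ?A" and max: "\<And>T'. T' \<in> ?A \<Longrightarrow> T \<subseteq> T' \<Longrightarrow> T = T'"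
    by auto
  have "f (char_input I (insert i T)) \<noteq> f (char_input I T)" if i: "i \<in> I - T" for i
  proof
    assume eq: "f (char_input I (insert i T)) = f (char_input I T)"
    \<comment> \<open>The monotone case needs equality at the two ends of the enlarged
      interval.\<close>
    then have eqS: "f (char_input I (insert i T)) = f (char_input I ?S)"
      using T unfolding constant_between_def by blast
    from assms(2) have "constant_between I f ?S (insert i T)"
    proof
      assume "symmetric_fun I f"
      then show ?thesis
        using constant_between_symmetric[OF assms(1) _ _ i _ _ eq] T by blast
    next
      assume "monotone_fun I f"
      then show ?thesis
        using constant_between_monotone eqS T by blast
    qed
    then have "insert i T \<in> ?A"
      using T i by blast
    then show False
      using max[of "insert i T"] i by blast
  qed
  then have "ms_at I f (char_input I T) = card (I - T)"
    using T by (intro ms_at_char_input) auto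
  moreover have "MCC_at I f x \<le> card (I - T)"
    using T by (intro MCC_at_le_card assms(1)) auto
  ultimately show ?thesis
    by (auto intro!: bexI[of _ "char_input I T"] char_input_in_cube)
qed

section \<open>Maxima over all inputs\<close>

lemma Max_image_mono_dominated:
  fixes g h :: "'a \<Rightarrow> 'b::linorder"
  assumes "finite A" "A \<noteq> {}" "\<And>x. x \<in> A \<Longrightarrow> \<exists>y\<in>A. g x \<le> h y"
  shows "Max (g ` A) \<le> Max (h ` A)"
proof (rule Max.boundedI)
  fix a assume "a \<in> g ` A"
  then obtain y where "y \<in> A" "a \<le> h y"
    using assms(3) by auto
  moreover have "h y \<le> Max (h ` A)"
    using \<open>y \<in> A\<close> assms(1) by simp
  ultimately show "a \<le> Max (h ` A)"
    by (meson order_trans)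
qed (use assms(1,2) in auto)

lemma cube_nonempty: "cube I \<noteq> {}"
  using char_input_in_cube by blast

lemma ms_le_mbs:
  assumes "finite I"
  shows "ms I f \<le> mbs I f"
proof -
  have "ms_at I f x \<le> mbs_at I f x" for x
    unfolding ms_at_def mbs_at_def using assms by (intro sensitivity_le_block_sensitivity) simp
  then show ?thesis
    unfolding ms_def mbs_def using assms
    by (intro Max_image_mono_dominated finite_cube cube_nonempty) blast+
qed

text \<open>This moves the embedding into the reals inside the maximum, where integer-valued
  measures can be compared with \<open>fmbs_at\<close> input by input.\<close>

lemma real_Max_image:
  assumes "finite A" "A \<noteq> {}"
  shows "real (Max (g ` A)) = Max ((\<lambda>x. real (g x)) ` A)"
  using mono_Max_commute[of real "g ` A"] assms by (simp add: mono_def image_image)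

lemma mbs_le_fmbs:
  assumes "finite I"
  shows "real (mbs I f) \<le> fmbs I f"
proof -
  have "real (mbs_at I f x) \<le> fmbs_at I f x" for x
    unfolding mbs_at_def fmbs_at_def using assms
    by (intro block_sensitivity_le_fractional_block_sensitivity zero_input_in_cube) simp
  then show ?thesis
    unfolding mbs_def fmbs_def real_Max_image[OF finite_cube[OF assms] cube_nonempty] using assms
    by (intro Max_image_mono_dominated finite_cube cube_nonempty) blast+
qed

lemma fmbs_le_MCC:
  assumes "finite I"
  shows "fmbs I f \<le> real (MCC I f)"
proof -
  have "fmbs_at I f x \<le> real (MCC_at I f x)" for x
    unfolding fmbs_at_def MCC_at_def using assms
    by (intro fractional_block_sensitivity_le_certificate_complexity zero_input_in_cube) simp
  then show ?thesis
    unfolding MCC_def fmbs_def real_Max_image[OF finite_cube[OF assms] cube_nonempty] using assms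
    by (intro Max_image_mono_dominated finite_cube cube_nonempty) blast+
qed

text \<open>This inequality holds only between maxima: for the threshold function "at least two
  ones" with \<open>n \<ge> 2\<close>, at the zero input \<open>ms_at\<close> is 0 and
  \<open>MCC_at\<close> is \<open>n - 1\<close>.\<close>

lemma MCC_le_ms:
  assumes "finite I" "symmetric_fun I f \<or> monotone_fun I f"
  shows "MCC I f \<le> ms I f"
  unfolding MCC_def ms_def
  using assms by (intro Max_image_mono_dominated finite_cube cube_nonempty MCC_at_le_ms_at)

theorem theorem3:
  fixes n :: nat and f :: "(nat \<Rightarrow> bool) \<Rightarrow> bool"
  assumes "symmetric_fun {1..n} f \<or> monotone_fun {1..n} f"
  shows "ms {1..n} f = mbs {1..n} f
       \<and> real (mbs {1..n} f) = fmbs {1..n} f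
       \<and> fmbs {1..n} f = real (MCC {1..n} f)"
  \<comment> \<open>The four inequalities form a cycle, so all of them are equalities.\<close>
  using ms_le_mbs[of "{1..n}" f] mbs_le_fmbs[of "{1..n}" f] fmbs_le_MCC[of "{1..n}" f]
    MCC_le_ms[OF _ assms] by simp

end
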